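(* Let $\alpha\ge 1$ and $n\ge 2$ be integers, and let $P(n,\alpha)=\langle x_1,x_2,\dots,x_n\mid w_n^{\alpha}\rangle$ be the one-relator presentation whose relator is defined recursively by $w_1=x_1$ and $$w_n=w_{n-1}\,x_n\prod_{j=1}^{n-1}(x_nx_{n-j})\qquad (n\ge 2).$$ Then the star-graph of $P(n,\alpha)$ is isomorphic to the complete bipartite graph $K_{n,n}$.
   Context: Products are written left to right in order of increasing $j$, so $w_n = w_{n-1}\,x_n\,(x_nx_{n-1})(x_nx_{n-2})\cdots(x_nx_1)$; for example $w_2=x_1x_2x_2x_1$. Star-graph: let $P=\langle X\mid R\rangle$ be a group presentation, and let $\widetilde R$ (the symmetrised closure of $R$) be the set of all elements of $R\cup R^{-1}$ together with all of their cyclic permutations. The star-graph of $P$ is the undirected labelled graph with vertex set $X^{\pm1}=X\cup X^{-1}$ in which an edge joins two vertices $x_1,x_2\in X^{\pm 1}$ whenever there is a relator of the form $x_1x_2^{-1}u$ or $x_2x_1^{-1}u^{-1}$ in $\widetilde R$. (So each cyclic subword $ab$ of a relator contributes an edge joining $a$ and $b^{-1}$.) *)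

theory Defs
  imports Graph_Theory.Graph_Theory
begin

section \<open>Words over X and its formal inverses, presentations\<close>

datatype 'a letter = Gen 'a | Inv 'a

primrec inv_letter :: "'a letter \<Rightarrow> 'a letter" where
  "inv_letter (Gen x) = Inv x"
| "inv_letter (Inv x) = Gen x"

type_synonym 'a word = "'a letter list"

definition inv_word :: "'a word \<Rightarrow> 'a word" where
  "inv_word u = rev (map inv_letter u)"

type_synonym 'a presentation = "'a set \<times> 'a word set"

definition symmetrised_closure :: "'a word set \<Rightarrow> 'a word set" where
  "symmetrised_closure R = {rotate k r | k r. r \<in> R \<union> inv_word ` R}"

section \<open>The star-graph\<close>

text \<open>
  As everywhere in the Graph-Theory entry, an undirected graph is a symmetric digraph. The arcs are
  the words of the symmetrised closure, so each arc is its own label: a word \<open>a b\<^sup>-\<^sup>1 u\<close> is an arc from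
  \<open>a\<close> to \<open>b\<close>. It forms one undirected edge together with the arc \<open>b a\<^sup>-\<^sup>1 u\<^sup>-\<^sup>1\<close>, which
  is a cyclic permutation of the inverse word and runs in the opposite direction. Distinct words
  give distinct arcs, so parallel edges are not identified.
\<close>

definition star_graph :: "'a presentation \<Rightarrow> ('a letter, 'a word) pre_digraph" where
  "star_graph P = (case P of (X, R) \<Rightarrow>
     \<lparr> verts = Gen ` X \<union> Inv ` X,
       arcs = {s \<in> symmetrised_closure R. length s \<ge> 2},
       tail = (\<lambda>s. s ! 0),
       head = (\<lambda>s. inv_letter (s ! 1)) \<rparr>)"

lemma inv_letter_inv_letter [simp]: "inv_letter (inv_letter a) = a"
  by (cases a) auto

lemma inv_word_inv_word [simp]: "inv_word (inv_word u) = u"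
  by (simp add: inv_word_def rev_map comp_def)

lemma symmetrised_closure_rotate:
  "s \<in> symmetrised_closure R \<Longrightarrow> rotate k s \<in> symmetrised_closure R"
  unfolding symmetrised_closure_def by (auto simp: rotate_rotate) blast+

lemma symmetrised_closure_inv_word:
  assumes "s \<in> symmetrised_closure R"
  shows "inv_word s \<in> symmetrised_closure R"
proof -
  from assms obtain k r where r: "r \<in> R \<union> inv_word ` R" and s: "s = rotate k r"
    unfolding symmetrised_closure_def by blast
  have "inv_word s = rotate (length r - k mod length r) (inv_word r)"
  proof (cases "r = [] \<or> k mod length r = 0")
    case True
    then have "rotate k r = r"
      using rotate_conv_mod[of k r] by auto
    then show ?thesis
      using True rotate_conv_mod[of "length r" "inv_word r"] by (auto simp: s inv_word_def)
  next
    case False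
    then have "k mod length r < length r"
      by simp
    with False have "length r - (length r - k mod length r) mod length r = k mod length r"
      by simp
    then show ?thesis
      using rotate_conv_mod[of k r] by (simp add: s inv_word_def rotate_map rotate_rev rev_map)
  qed
  moreover have "inv_word r \<in> R \<union> inv_word ` R"
    using r by auto
  ultimately show ?thesis
    unfolding symmetrised_closure_def by blast
qed

lemma symmetrised_closure_reverse:
  assumes "a # inv_letter b # u \<in> symmetrised_closure R"
  shows "b # inv_letter a # inv_word u \<in> symmetrised_closure R"
proof -
  have "inv_word (a # inv_letter b # u) = inv_word u @ [b, inv_letter a]"
    by (simp add: inv_word_def)
  then have "rotate (length (inv_word u)) (inv_word (a # inv_letter b # u))
      = b # inv_letter a # inv_word u"
    by (simp add: rotate_append)
  then show ?thesis
    using symmetrised_closure_rotate symmetrised_closure_inv_word assms by metis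
qed

text \<open>Adjacency in the form in which the star-graph is usually defined.\<close>

lemma adjacent_star_graph_iff:
  "a \<rightarrow>\<^bsub>star_graph (X, R)\<^esub> b \<longleftrightarrow>
     (\<exists>u. a # inv_letter b # u \<in> symmetrised_closure R \<or>
          b # inv_letter a # inv_word u \<in> symmetrised_closure R)" (is "?l = ?r")
proof
  assume ?l
  then obtain s where s: "s \<in> symmetrised_closure R" "length s \<ge> 2"
      "a = s ! 0" "b = inv_letter (s ! 1)"
    by (auto simp: star_graph_def arcs_ends_conv)
  from s(2) obtain c d u where "s = c # d # u"
    by (metis One_nat_def Suc_1 Suc_le_length_iff)
  with s show ?r by auto
next
  assume ?r
  then obtain u where "a # inv_letter b # u \<in> symmetrised_closure R"
    using symmetrised_closure_reverse[of b a] by fastforce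
  then show ?l
    by (force simp: star_graph_def arcs_ends_conv image_iff)
qed

lemma symmetric_star_graph: "symmetric (star_graph (X, R))"
  unfolding symmetric_def
proof (rule symI)
  fix a b assume "a \<rightarrow>\<^bsub>star_graph (X, R)\<^esub> b"
  then show "b \<rightarrow>\<^bsub>star_graph (X, R)\<^esub> a"
    unfolding adjacent_star_graph_iff by (metis inv_word_inv_word)
qed

section \<open>The presentations and the complete bipartite graph\<close>

text \<open>The generator \<open>x\<^sub>i\<close> is \<open>Gen i\<close>. The value at \<open>0\<close> is irrelevant.\<close>

fun w :: "nat \<Rightarrow> nat word" where
  "w 0 = []"
| "w (Suc 0) = [Gen 1]"
| "w (Suc (Suc m)) = (let n = Suc (Suc m) in
     w (Suc m) @ [Gen n] @ concat (map (\<lambda>j. [Gen n, Gen (n - j)]) [1..<n]))"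

lemma w_1: "w 1 = [Gen 1]"
  by simp

lemma w_rec:
  "n \<ge> 2 \<Longrightarrow> w n = w (n - 1) @ [Gen n] @ concat (map (\<lambda>j. [Gen n, Gen (n - j)]) [1..<n])"
  by (cases n rule: w.cases) (auto simp: Let_def)

lemma w_2: "w 2 = [Gen 1, Gen 2, Gen 2, Gen 1]"
  by (simp add: w_rec upt_rec)

definition P :: "nat \<Rightarrow> nat \<Rightarrow> nat presentation" where
  "P n \<alpha> = ({1..n}, {concat (replicate \<alpha> (w n))})"

definition complete_bipartite_graph :: "nat \<Rightarrow> nat \<Rightarrow> (nat + nat) pair_pre_digraph" where
  "complete_bipartite_graph m n =
     \<lparr> pverts = Inl ` {..<m} \<union> Inr ` {..<n},
       parcs = Inl ` {..<m} \<times> Inr ` {..<n} \<union> Inr ` {..<n} \<times> Inl ` {..<m} \<rparr>"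

lemma complete_bipartite_digraph_complete_bipartite_graph:
  "K\<^bsub>m,n\<^esub> (with_proj (complete_bipartite_graph m n))"
  unfolding complete_bipartite_digraph_pair_def complete_bipartite_graph_def
  by (intro conjI exI[of _ "Inl ` {..<m}"] exI[of _ "Inr ` {..<n}"]) (auto simp: card_image)

end

theory Submission
  imports Defs
begin

text \<open>
  The word \<open>w n\<close> is cyclically a de Bruijn word of order two: read around a circle, each of the
  \<open>n * n\<close> ordered pairs of generators occurs exactly once as a pair of neighbouring letters
  (\<open>cyclic_pairs_w\<close>, \<open>length_w\<close>). The recursion is built for this: passing from \<open>n - 1\<close> to \<open>n\<close>
  inserts, between the last and the first letter of \<open>w (n - 1)\<close>, which are both \<open>x\<^sub>1\<close>, a closed
  walk that uses each pair involving \<open>x\<^sub>n\<close> once.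

  Consequently a cyclic permutation of \<open>w n ^ \<alpha>\<close> is determined by its first two letters, and these
  may be any two generators \<open>a\<close>, \<open>b\<close> (\<open>bij_betw_rotations_power\<close>). It is an arc from \<open>a\<close> to the
  inverse of \<open>b\<close>. Likewise the cyclic permutations of the inverse relator give exactly one arc from
  each inverse generator to each generator (\<open>cyclic_pairs_inv_word\<close>). The star-graph therefore has
  exactly one edge between each generator and each inverse generator, and no other edge.
\<close>

section \<open>Neighbouring letters\<close>

definition adjacent_pairs :: "'a list \<Rightarrow> ('a \<times> 'a) set" where
  "adjacent_pairs xs = set (zip xs (tl xs))"

definition cyclic_pairs :: "'a list \<Rightarrow> ('a \<times> 'a) set" where
  "cyclic_pairs xs = set (zip xs (rotate1 xs))"

lemma adjacent_pairs_simps [simp]: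
  "adjacent_pairs [] = {}"
  "adjacent_pairs [x] = {}"
  "adjacent_pairs (x # y # ys) = insert (x, y) (adjacent_pairs (y # ys))"
  by (simp_all add: adjacent_pairs_def)

lemma adjacent_pairs_append:
  assumes "xs \<noteq> []" and "ys \<noteq> []"
  shows "adjacent_pairs (xs @ ys) =
    adjacent_pairs xs \<union> {(last xs, hd ys)} \<union> adjacent_pairs ys"
  using assms
proof (induction xs rule: induct_list012)
  case (2 x)
  then show ?case by (cases ys) auto
qed auto

lemma cyclic_pairs_conv_adjacent_pairs:
  assumes "xs \<noteq> []"
  shows "cyclic_pairs xs = insert (last xs, hd xs) (adjacent_pairs xs)"
proof -
  obtain y ys where xs: "xs = y # ys"
    using assms by (cases xs) auto
  have "adjacent_pairs (xs @ [y]) = insert (last xs, hd xs) (adjacent_pairs xs)"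
    using adjacent_pairs_append[of xs "[y]"] by (simp add: xs)
  moreover have "zip (xs @ [y]) (tl (xs @ [y])) = zip xs (rotate1 xs)"
    using zip_append1[of "y # ys" "[y]" "ys @ [y]"] by (simp add: xs)
  ultimately show ?thesis
    by (simp add: cyclic_pairs_def adjacent_pairs_def)
qed

lemma cyclic_pairs_subset: "cyclic_pairs xs \<subseteq> set xs \<times> set xs"
  unfolding cyclic_pairs_def by (auto dest: set_zip_leftD set_zip_rightD)

lemma zip_rotate1:
  assumes "length xs = length ys"
  shows "zip (rotate1 xs) (rotate1 ys) = rotate1 (zip xs ys)"
  using assms by (cases xs; cases ys) auto

lemma cyclic_pairs_rotate1 [simp]: "cyclic_pairs (rotate1 xs) = cyclic_pairs xs"
  by (simp add: cyclic_pairs_def zip_rotate1)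

lemma set_zip_swap: "set (zip xs ys) = prod.swap ` set (zip ys xs)"
  by (force simp: in_set_zip)

text \<open>
  Reversal turns the successor of a letter into its predecessor. To see that the pair at the wrap
  from the last letter to the first is treated like all others, a rotation of the inverse word is
  chosen for which its list of cyclic pairs is literally the reversal of the list for \<open>u\<close>.
\<close>

lemma cyclic_pairs_inv_word:
  "cyclic_pairs (inv_word u) = (\<lambda>(a, b). (inv_letter b, inv_letter a)) ` cyclic_pairs u"
proof (cases u)
  case (Cons x xs)
  define y ys where "y = inv_letter x" and "ys = map inv_letter xs"
  have "inv_word u = rotate1 (y # rev ys)"
    by (simp add: Cons inv_word_def y_def ys_def rev_map)
  then have "cyclic_pairs (inv_word u) = set (zip (y # rev ys) (rev ys @ [y]))"
    by (simp only: cyclic_pairs_rotate1) (simp add: cyclic_pairs_def)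
  also have "zip (y # rev ys) (rev ys @ [y]) = rev (zip (ys @ [y]) (y # ys))"
    by (simp add: zip_rev[symmetric])
  also have "set \<dots> = prod.swap ` set (zip (y # ys) (ys @ [y]))"
    by (simp only: set_rev set_zip_swap[of "ys @ [y]"])
  also have "zip (y # ys) (ys @ [y]) =
      map (map_prod inv_letter inv_letter) (zip (x # xs) (xs @ [x]))"
    using zip_map_map[of inv_letter "x # xs" inv_letter "xs @ [x]"]
    by (simp add: y_def ys_def map_prod_def)
  finally show ?thesis
    by (simp add: Cons cyclic_pairs_def image_image prod.swap_def map_prod_def case_prod_unfold)
qed (simp add: cyclic_pairs_def inv_word_def)

section \<open>Cyclic permutations of a power of a word\<close>

lemma nth_concat_replicate:
  assumes "i < m * length v"
  shows "concat (replicate m v) ! i = v ! (i mod length v)"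
  using assms
proof (induction m arbitrary: i)
  case (Suc m)
  then show ?case
    by (cases "i < length v") (auto simp: nth_append le_mod_geq)
qed simp

lemma length_concat_replicate: "length (concat (replicate m v)) = m * length v"
  by (induction m) auto

lemma nth_rotate_power:
  assumes "i < m * length v"
  shows "rotate k (concat (replicate m v)) ! i = v ! ((k + i) mod length v)"
proof -
  have "(k + i) mod (m * length v) < m * length v"
    using assms by (intro mod_less_divisor) (rule le_less_trans[OF le0])
  with assms show ?thesis
    by (simp add: nth_rotate length_concat_replicate nth_concat_replicate mod_mod_cancel)
qed

text \<open>
  Shifting the power \<open>v ^ m\<close> by \<open>k\<close> depends only on \<open>k\<close> modulo the length of \<open>v\<close>, and if the cyclic
  pairs of \<open>v\<close> are distinct, then that residue can be read off from the first two letters.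
\<close>

lemma bij_betw_rotations_power:
  assumes dist: "distinct (zip v (rotate1 v))" and len: "m * length v \<ge> 2"
  shows "bij_betw (\<lambda>s. (s ! 0, s ! 1)) (range (\<lambda>k. rotate k (concat (replicate m v))))
           (cyclic_pairs v)"
proof -
  let ?L = "length v" and ?r = "\<lambda>k. rotate k (concat (replicate m v))"
  have L: "?L > 0"
    using len by (cases v) auto
  have pair: "(?r k ! 0, ?r k ! 1) = zip v (rotate1 v) ! (k mod ?L)" for k
  proof -
    have "?r k ! 0 = v ! (k mod ?L)" and "?r k ! 1 = v ! (Suc k mod ?L)"
      using len nth_rotate_power[of 0 m v k, OF less_le_trans[OF _ len]]
        nth_rotate_power[of 1 m v k] by simp_all
    then show ?thesis
      using L by (simp add: nth_rotate1 mod_Suc_eq)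
  qed
  have "inj_on (\<lambda>s. (s ! 0, s ! 1)) (range ?r)"
  proof (rule inj_onI, elim rangeE)
    fix s s' k k'
    assume s: "s = ?r k" "s' = ?r k'" and "(s ! 0, s ! 1) = (s' ! 0, s' ! 1)"
    then have "zip v (rotate1 v) ! (k mod ?L) = zip v (rotate1 v) ! (k' mod ?L)"
      by (simp only: pair)
    then have "k mod ?L = k' mod ?L"
      using L nth_eq_iff_index_eq[OF dist, of "k mod ?L" "k' mod ?L"] by (simp del: nth_zip)
    then have "(k + i) mod ?L = (k' + i) mod ?L" for i
      by (metis mod_add_left_eq)
    then show "s = s'"
      unfolding s by (intro nth_equalityI) (simp_all add: length_concat_replicate nth_rotate_power)
  qed
  moreover have "(\<lambda>s. (s ! 0, s ! 1)) ` range ?r = cyclic_pairs v"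
  proof -
    have "{..<?L} \<subseteq> range (\<lambda>k. k mod ?L)"
    proof
      fix i assume "i \<in> {..<?L}"
      then have "i = i mod ?L"
        by simp
      then show "i \<in> range (\<lambda>k. k mod ?L)"
        by (rule range_eqI)
    qed
    then have residues: "range (\<lambda>k. k mod ?L) = {..<?L}"
      using L by auto
    have "(\<lambda>s. (s ! 0, s ! 1)) ` range ?r = (!) (zip v (rotate1 v)) ` range (\<lambda>k. k mod ?L)"
      by (simp only: image_image pair)
    also have "\<dots> = (!) (zip v (rotate1 v)) ` {..<?L}"
      by (simp only: residues)
    also have "\<dots> = cyclic_pairs v"
      by (auto simp: cyclic_pairs_def set_conv_nth simp del: nth_zip)
    finally show ?thesis .
  qed
  ultimately show ?thesis
    by (simp add: bij_betw_def)
qed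

text \<open>A word over an alphabet of \<open>n\<close> letters in which all pairs occur has no room for repetitions
  if its length is \<open>n * n\<close>.\<close>

lemma bij_betw_rotations_power_of_all_pairs:
  assumes "cyclic_pairs v = A \<times> A" and "length v = card A * card A" and "m * length v \<ge> 2"
  shows "bij_betw (\<lambda>s. (s ! 0, s ! 1)) (range (\<lambda>k. rotate k (concat (replicate m v)))) (A \<times> A)"
proof -
  have "card (set (zip v (rotate1 v))) = length (zip v (rotate1 v))"
    using assms by (simp add: cyclic_pairs_def card_cartesian_product)
  then have "distinct (zip v (rotate1 v))"
    by (rule card_distinct)
  from bij_betw_rotations_power[OF this assms(3)] show ?thesis
    by (simp only: assms(1))
qed

lemma inv_word_power: "inv_word (concat (replicate m v)) = concat (replicate m (inv_word v))"
proof (induction m)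
  case (Suc m)
  have "inv_word (concat (replicate (Suc m) v)) = inv_word (concat (replicate m v)) @ inv_word v"
    by (simp add: inv_word_def)
  also have "\<dots> = concat (replicate m (inv_word v) @ [inv_word v])"
    by (simp add: Suc.IH)
  finally show ?case
    by (simp add: replicate_append_same)
qed (simp add: inv_word_def)

section \<open>The word \<open>w n\<close> contains every pair of generators\<close>

lemma w_Suc:
  "m \<ge> 1 \<Longrightarrow> w (Suc m) =
     w m @ Gen (Suc m) # concat (map (\<lambda>j. [Gen (Suc m), Gen (Suc m - j)]) [1..<Suc m])"
  using w_rec[of "Suc m"] by simp

lemma w_nonempty: "n \<ge> 1 \<Longrightarrow> w n \<noteq> []"
  by (induction n rule: nat_induct_at_least) (simp_all add: w_Suc del: w.simps(3))

lemma hd_w: "n \<ge> 1 \<Longrightarrow> hd (w n) = Gen 1"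
  by (induction n rule: nat_induct_at_least) (simp_all add: w_Suc w_nonempty del: w.simps(3))

lemma last_w: "n \<ge> 1 \<Longrightarrow> last (w n) = Gen 1"
  by (induction n rule: nat_induct_at_least) (simp_all add: w_Suc del: w.simps(3))

lemma length_concat_map_pair: "length (concat (map (\<lambda>j. [a, f j]) js)) = 2 * length js"
  by (induction js) auto

lemma length_w: "n \<ge> 1 \<Longrightarrow> length (w n) = n * n"
  by (induction n rule: nat_induct_at_least)
    (simp_all add: w_Suc length_concat_map_pair del: w.simps(3))

lemma set_w: "n \<ge> 1 \<Longrightarrow> set (w n) \<subseteq> Gen ` {1..n}"
  by (induction n rule: nat_induct_at_least) (auto simp: w_Suc simp del: w.simps(3))

text \<open>The last letter \<open>f j\<close> of the listed word has no successor, hence \<open>butlast\<close>. In \<open>w n\<close>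
  it is \<open>x\<^sub>1\<close>, and the pair \<open>x\<^sub>1 x\<^sub>n\<close> occurs instead where \<open>w (n - 1)\<close> meets the first \<open>x\<^sub>n\<close>.\<close>

lemma adjacent_pairs_alternating:
  "adjacent_pairs (x # concat (map (\<lambda>j. [a, f j]) js)) =
     (if js = [] then {} else {(x, a)}) \<union> {a} \<times> f ` set js \<union> f ` set (butlast js) \<times> {a}"
proof (induction js arbitrary: x)
  case (Cons j js)
  show ?case
    by (auto simp: Cons.IH)
qed simp

lemma image_minus_atLeastAtMost_nat:
  fixes a b c :: nat
  assumes "a \<le> c" and "b \<le> c"
  shows "(-) c ` {a..b} = {c - b..c - a}"
proof
  show "{c - b..c - a} \<subseteq> (-) c ` {a..b}"
  proof
    fix x assume "x \<in> {c - b..c - a}"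
    then have "x = c - (c - x)" and "c - x \<in> {a..b}"
      using assms by auto
    then show "x \<in> (-) c ` {a..b}"
      by blast
  qed
qed auto

text \<open>
  Only the wrap pair \<open>x\<^sub>1 x\<^sub>1\<close> of \<open>w m\<close> is interrupted by the new letters, and it reappears as the
  wrap pair of \<open>w (m + 1)\<close>, since that word begins and ends with \<open>x\<^sub>1\<close> as well. The new letters
  contribute the pairs that contain the new generator. Occurrence of each pair suffices here:
  uniqueness follows by counting, from the length of \<open>w n\<close>.
\<close>

lemma all_pairs_in_cyclic_pairs_w:
  "n \<ge> 1 \<Longrightarrow> Gen ` {1..n} \<times> Gen ` {1..n} \<subseteq> cyclic_pairs (w n)"
proof (induction n rule: nat_induct_at_least)
  case base
  show ?case by (simp add: cyclic_pairs_def)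
next
  case (Suc m)
  let ?g = "Gen (Suc m) :: nat letter" and ?f = "\<lambda>j. Gen (Suc m - j) :: nat letter"
  let ?t = "concat (map (\<lambda>j. [?g, ?f j]) [1..<Suc m])"
  have f_image: "?f ` A = Gen ` (-) (Suc m) ` A" for A
    by (simp only: image_image)
  have "set [1..<Suc m] = {1..m}"
    by auto
  moreover have "(-) (Suc m) ` {1..m} = {1..m}"
    by (subst image_minus_atLeastAtMost_nat) auto
  ultimately have f: "?f ` set [1..<Suc m] = Gen ` {1..m}"
    by (simp only: f_image)
  have "set (butlast [1..<Suc m]) = {1..m - 1}"
    by auto
  moreover have "(-) (Suc m) ` {1..m - 1} = {2..m}"
    using Suc.hyps by (subst image_minus_atLeastAtMost_nat) auto
  ultimately have fb: "?f ` set (butlast [1..<Suc m]) = Gen ` {2..m}"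
    by (simp only: f_image)
  have w: "w (Suc m) = w m @ ?g # ?t"
    using Suc.hyps by (rule w_Suc)
  have "cyclic_pairs (w (Suc m)) =
      insert (Gen 1, Gen 1) (adjacent_pairs (w m @ ?g # ?t))"
    using hd_w[of "Suc m"] last_w[of "Suc m"] w_nonempty[of "Suc m"]
    by (simp add: cyclic_pairs_conv_adjacent_pairs w)
  also have "adjacent_pairs (w m @ ?g # ?t) =
      adjacent_pairs (w m) \<union> {(Gen 1, ?g)} \<union> adjacent_pairs (?g # ?t)"
    using Suc.hyps by (subst adjacent_pairs_append) (simp_all add: w_nonempty last_w)
  also have "adjacent_pairs (?g # ?t) =
      {(?g, ?g)} \<union> {?g} \<times> Gen ` {1..m} \<union> Gen ` {2..m} \<times> {?g}"
    using Suc.hyps unfolding adjacent_pairs_alternating f fb by simp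
  finally have eq: "cyclic_pairs (w (Suc m)) =
      insert (Gen 1, Gen 1) (adjacent_pairs (w m)) \<union> {(Gen 1, ?g)} \<union> ({(?g, ?g)}
        \<union> {?g} \<times> Gen ` {1..m} \<union> Gen ` {2..m} \<times> {?g})"
    by blast
  have "insert (Gen 1, Gen 1) (adjacent_pairs (w m)) = cyclic_pairs (w m)"
    using Suc.hyps by (simp add: cyclic_pairs_conv_adjacent_pairs w_nonempty hd_w last_w)
  with Suc.IH have "Gen ` {1..m} \<times> Gen ` {1..m} \<subseteq> insert (Gen 1, Gen 1) (adjacent_pairs (w m))"
    by simp
  moreover have "{1..Suc m} = insert (Suc m) {1..m}" and "{1..m} = insert 1 {2..m}"
    using Suc.hyps by auto
  ultimately show ?case
    unfolding eq by (simp only: image_insert) blast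
qed

lemma cyclic_pairs_w:
  assumes "n \<ge> 1"
  shows "cyclic_pairs (w n) = Gen ` {1..n} \<times> Gen ` {1..n}"
  using all_pairs_in_cyclic_pairs_w[OF assms] cyclic_pairs_subset[of "w n"] set_w[OF assms] by blast

lemma cyclic_pairs_inv_word_w:
  assumes "n \<ge> 1"
  shows "cyclic_pairs (inv_word (w n)) = Inv ` {1..n} \<times> Inv ` {1..n}"
  unfolding cyclic_pairs_inv_word cyclic_pairs_w[OF assms] by force

section \<open>The star-graph\<close>

lemma arcs_star_graph_P:
  assumes "\<alpha> * length (w n) \<ge> 2"
  shows "arcs (star_graph (P n \<alpha>)) =
    range (\<lambda>k. rotate k (concat (replicate \<alpha> (w n)))) \<union>
    range (\<lambda>k. rotate k (concat (replicate \<alpha> (inv_word (w n)))))"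
proof -
  have "symmetrised_closure {concat (replicate \<alpha> (w n))} =
    range (\<lambda>k. rotate k (concat (replicate \<alpha> (w n)))) \<union>
    range (\<lambda>k. rotate k (concat (replicate \<alpha> (inv_word (w n)))))"
    unfolding symmetrised_closure_def by (auto simp: inv_word_power)
  with assms show ?thesis
    by (auto simp: star_graph_def P_def length_concat_replicate inv_word_def)
qed

lemma bij_betw_arcs_star_graph_P:
  assumes "\<alpha> \<ge> 1" and "n \<ge> 2"
  shows "bij_betw (\<lambda>s. (s ! 0, inv_letter (s ! 1))) (arcs (star_graph (P n \<alpha>)))
    (Gen ` {1..n} \<times> Inv ` {1..n} \<union> Inv ` {1..n} \<times> Gen ` {1..n})"
proof -
  let ?e = "\<lambda>s :: nat word. (s ! 0, inv_letter (s ! 1))"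
  have card: "card (Gen ` {1..n}) = n" "card (Inv ` {1..n}) = n"
    by (simp_all add: card_image inj_on_def)
  have len: "length (w n) = n * n" "length (inv_word (w n)) = n * n"
    using assms by (simp_all add: length_w inv_word_def)
  \<comment> \<open>Only words of at least two letters are arcs, and the relator has \<open>\<alpha> * (n * n)\<close> letters.\<close>
  have "1 * (2 * 1) \<le> \<alpha> * (n * n)"
    using assms by (intro mult_mono) auto
  then have two: "\<alpha> * (n * n) \<ge> 2"
    by simp
  have inv_snd: "bij_betw (\<lambda>(a, b). (a, inv_letter b)) (A \<times> B) (A \<times> inv_letter ` B)"
    for A B :: "nat letter set"
    by (rule bij_betw_imageI) (auto simp: inj_on_def image_iff dest: arg_cong[of _ _ inv_letter])
  have e: "bij_betw ?e (range (\<lambda>k. rotate k (concat (replicate \<alpha> v)))) (A \<times> inv_letter ` A)"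
    if "cyclic_pairs v = A \<times> A" "card A = n" "length v = n * n" for v A
    using bij_betw_trans[OF bij_betw_rotations_power_of_all_pairs[of v A \<alpha>] inv_snd[of A A]]
      that two by (simp add: comp_def)
  have inv: "inv_letter ` Gen ` {1..n} = Inv ` {1..n}" "inv_letter ` Inv ` {1..n} = Gen ` {1..n}"
    by (simp_all add: image_image)
  have "bij_betw ?e (range (\<lambda>k. rotate k (concat (replicate \<alpha> (w n)))))
      (Gen ` {1..n} \<times> Inv ` {1..n})"
    using e[of "w n" "Gen ` {1..n}"] assms
    by (simp only: cyclic_pairs_w card len inv)
  moreover have "bij_betw ?e (range (\<lambda>k. rotate k (concat (replicate \<alpha> (inv_word (w n))))))
      (Inv ` {1..n} \<times> Gen ` {1..n})"
    using e[of "inv_word (w n)" "Inv ` {1..n}"] assms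
    by (simp only: cyclic_pairs_inv_word_w card len inv)
  ultimately show ?thesis
    unfolding arcs_star_graph_P[OF two[folded len(1)]] by (rule bij_betw_combine) auto
qed

text \<open>Generators form one side of the bipartition and their inverses the other; the shift by one
  turns the indices \<open>1, \<dots>, n\<close> into \<open>0, \<dots>, n - 1\<close>.\<close>

fun side_vertex :: "nat letter \<Rightarrow> nat + nat" where
  "side_vertex (Gen i) = Inl (i - 1)"
| "side_vertex (Inv i) = Inr (i - 1)"

lemma side_vertex_image:
  "side_vertex ` Gen ` {1..n} = Inl ` {..<n}" "side_vertex ` Inv ` {1..n} = Inr ` {..<n}"
proof -
  have "(\<lambda>i. i - 1) ` {1..n} = {..<n}"
    by (auto intro!: image_eqI[of _ _ "Suc _"])
  then show "side_vertex ` Gen ` {1..n} = Inl ` {..<n}" "side_vertex ` Inv ` {1..n} = Inr ` {..<n}"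
    unfolding image_image side_vertex.simps by (metis image_image)+
qed

lemma inj_on_side_vertex: "inj_on side_vertex (Gen ` {1..n} \<union> Inv ` {1..n})"
  by (auto simp: inj_on_def)

theorem theorem1:
  fixes n \<alpha> :: nat
  assumes "\<alpha> \<ge> 1" and "n \<ge> 2"
  shows "digraph_iso (star_graph (P n \<alpha>)) (with_proj (complete_bipartite_graph n n))"
proof -
  let ?G = "star_graph (P n \<alpha>)"
  let ?gs = "Gen ` {1..n} :: nat letter set" and ?is = "Inv ` {1..n} :: nat letter set"
  let ?E = "?gs \<times> ?is \<union> ?is \<times> ?gs"
  let ?e = "\<lambda>s :: nat word. (s ! 0, inv_letter (s ! 1))"
  let ?f = "map_prod side_vertex side_vertex"
  define h where "h = \<lparr>iso_verts = side_vertex, iso_arcs = ?f \<circ> ?e, iso_head = snd, iso_tail = fst\<rparr>"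
  have G: "verts ?G = ?gs \<union> ?is" "tail ?G = (\<lambda>s. s ! 0)" "head ?G = (\<lambda>s. inv_letter (s ! 1))"
    by (simp_all add: star_graph_def P_def)
  have e: "bij_betw ?e (arcs ?G) ?E"
    using assms by (rule bij_betw_arcs_star_graph_P)
  have E: "?E \<subseteq> (?gs \<union> ?is) \<times> (?gs \<union> ?is)"
    by blast
  have ends: "?e s \<in> ?E" if "s \<in> arcs ?G" for s
    using bij_betwE[OF e] that by blast
  have "wf_digraph ?G"
    using ends by unfold_locales (fastforce simp: G)+
  moreover have "inj_on (?f \<circ> ?e) (arcs ?G)"
  proof (rule comp_inj_on)
    show "inj_on ?e (arcs ?G)"
      using e by (rule bij_betw_imp_inj_on)
    show "inj_on ?f (?e ` arcs ?G)"
      using map_prod_inj_on[OF inj_on_side_vertex inj_on_side_vertex] E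
      unfolding bij_betw_imp_surj_on[OF e] by (rule inj_on_subset)
  qed
  ultimately have "pre_digraph.digraph_isomorphism ?G h"
    using inj_on_side_vertex[of n] by (simp add: pre_digraph.digraph_isomorphism_def h_def G)
  moreover have "with_proj (complete_bipartite_graph n n) = app_iso h ?G"
  proof -
    have "(?f \<circ> ?e) ` arcs ?G = ?f ` ?E"
      by (simp only: image_comp[symmetric] bij_betw_imp_surj_on[OF e])
    also have "\<dots> = Inl ` {..<n} \<times> Inr ` {..<n} \<union> Inr ` {..<n} \<times> Inl ` {..<n}"
      by (simp only: image_Un map_prod_surj_on[OF refl refl] side_vertex_image)
    finally show ?thesis
      by (simp add: app_iso_def with_proj_def complete_bipartite_graph_def h_def G image_Un
          side_vertex_image[simplified])
  qed
  ultimately show ?thesis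
    unfolding digraph_iso_def by blast
qed

end
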